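(* Let $(V,b,m)$ be an infinite, locally finite, connected graph over a non-Archimedean ordered field $\mathbb K$ which is Cauchy complete and has countable cofinality. If the graph has positive capacity, then there exists a strictly positive non-constant superharmonic function $u:V\to\mathbb K^+$.
   Context: An ordered field $(\mathbb K,\succ)$ is non-Archimedean if there is $\tau\succ0$ with $\tau\prec 1/n$ for all $n\in\mathbb N$. $\mathbb K^+=\{k\in\mathbb K: k\succ0\}$. A sequence $(k_n)$ converges to $k\in\mathbb K$ if for every $c\in\mathbb K^+$ one has $|k_n-k|\preceq c$ for all large $n$. Cauchy complete: every Cauchy sequence converges. Countable cofinality: there is a countable $S\subset\mathbb K$ such that every $k\in\mathbb K$ satisfies $k\preceq s$ for some $s\in S$. A graph $(V,b,m)$ over $\mathbb K$: $V$ is an at most countable set, $m:V\to\mathbb K^+$, and $b:V\times V\to\mathbb K^+\cup\{0\}$ is symmetric with $b(x,x)=0$. Write $x\sim y$ if $b(x,y)\neq0$; locally finite means each vertex has finitely many neighbors; connectedness is with respect to paths $x_0\sim x_1\sim\dots\sim x_n$, and $d$ is the combinatorial graph distance. $B_n(a)=\{x\in V: d(a,x)<n\}$. Laplacian: $\Delta f(x)=\frac1{m(x)}\sum_{y\in V}(f(x)-f(y))b(x,y)$ for $f:V\to\mathbb K$. A function $u:V\to\mathbb K$ is superharmonic if $\Delta u\succeq0$ on $V$. For a finite connected $K\subseteq V$ and $a\in K$ there is a unique $v:V\to\mathbb K$ with $\Delta v=0$ on $K\setminus\{a\}$, $v(a)=1$, $v=0$ on $V\setminus K$; put $\mathrm{cap}_K(a)=\Delta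 v(a)m(a)$ and $\mathrm{cap}_n(a)=\mathrm{cap}_{B_n(a)}(a)$, $n\ge1$. The graph has positive capacity if $\mathrm{cap}(a)=\lim_{n\to\infty}\mathrm{cap}_n(a)$ exists in $\mathbb K$ and is nonzero for some (equivalently, all) $a\in V$. *)

theory Defs
  imports Main "HOL-Library.Countable_Set"
begin

section \<open>Ordered fields\<close>

text \<open>The field is an arbitrary type of class \<^class>\<open>linordered_field\<close>, which carries no topology;
  limits refer to tolerances in the field itself. The \<open>itself\<close> argument only selects the type.\<close>

definition non_archimedean :: "'k::linordered_field itself \<Rightarrow> bool" where
  "non_archimedean T \<longleftrightarrow> (\<exists>\<tau>::'k. \<tau> > 0 \<and> (\<forall>n::nat. n \<ge> 1 \<longrightarrow> \<tau> < 1 / of_nat n))"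

definition converges_to :: "(nat \<Rightarrow> 'k::linordered_field) \<Rightarrow> 'k \<Rightarrow> bool" where
  "converges_to s l \<longleftrightarrow> (\<forall>c>0. \<exists>N. \<forall>n\<ge>N. \<bar>s n - l\<bar> \<le> c)"

definition cauchy_seq :: "(nat \<Rightarrow> 'k::linordered_field) \<Rightarrow> bool" where
  "cauchy_seq s \<longleftrightarrow> (\<forall>c>0. \<exists>N. \<forall>i\<ge>N. \<forall>j\<ge>N. \<bar>s i - s j\<bar> \<le> c)"

definition cauchy_complete :: "'k::linordered_field itself \<Rightarrow> bool" where
  "cauchy_complete T \<longleftrightarrow> (\<forall>s :: nat \<Rightarrow> 'k. cauchy_seq s \<longrightarrow> (\<exists>l. converges_to s l))"

definition countable_cofinality :: "'k::linordered_field itself \<Rightarrow> bool" where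
  "countable_cofinality T \<longleftrightarrow> (\<exists>S :: 'k set. countable S \<and> (\<forall>k. \<exists>s\<in>S. k \<le> s))"

section \<open>Graphs over an ordered field\<close>

text \<open>The vertex set is a carrier set; the values of \<open>b\<close>, \<open>m\<close> and of functions on vertices are
  irrelevant outside it.\<close>

locale weighted_graph =
  fixes V :: "'v set"
    and b :: "'v \<Rightarrow> 'v \<Rightarrow> 'k::linordered_field"
    and m :: "'v \<Rightarrow> 'k"
  assumes countable_V: "countable V"
    and m_pos: "x \<in> V \<Longrightarrow> m x > 0"
    and b_nonneg: "x \<in> V \<Longrightarrow> y \<in> V \<Longrightarrow> b x y \<ge> 0"
    and b_sym: "x \<in> V \<Longrightarrow> y \<in> V \<Longrightarrow> b x y = b y x"
    and b_diag: "x \<in> V \<Longrightarrow> b x x = 0"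

definition adj :: "'v set \<Rightarrow> ('v \<Rightarrow> 'v \<Rightarrow> 'k::linordered_field) \<Rightarrow> 'v \<Rightarrow> 'v \<Rightarrow> bool" where
  "adj V b x y \<longleftrightarrow> x \<in> V \<and> y \<in> V \<and> b x y \<noteq> 0"

definition graph_locally_finite :: "'v set \<Rightarrow> ('v \<Rightarrow> 'v \<Rightarrow> 'k::linordered_field) \<Rightarrow> bool" where
  "graph_locally_finite V b \<longleftrightarrow> (\<forall>x\<in>V. finite {y. adj V b x y})"

definition graph_connected :: "'v set \<Rightarrow> ('v \<Rightarrow> 'v \<Rightarrow> 'k::linordered_field) \<Rightarrow> bool" where
  "graph_connected V b \<longleftrightarrow> (\<forall>x\<in>V. \<forall>y\<in>V. (adj V b)\<^sup>*\<^sup>* x y)"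

text \<open>Length of a shortest path; meaningful for \<open>x\<close> and \<open>y\<close> joined by some path.\<close>

definition graph_dist :: "'v set \<Rightarrow> ('v \<Rightarrow> 'v \<Rightarrow> 'k::linordered_field) \<Rightarrow> 'v \<Rightarrow> 'v \<Rightarrow> nat" where
  "graph_dist V b x y = (LEAST n. (adj V b ^^ n) x y)"

definition graph_ball :: "'v set \<Rightarrow> ('v \<Rightarrow> 'v \<Rightarrow> 'k::linordered_field) \<Rightarrow> 'v \<Rightarrow> nat \<Rightarrow> 'v set" where
  "graph_ball V b a n = {x \<in> V. graph_dist V b a x < n}"

text \<open>The sum over all of \<open>V\<close> is taken over the neighbours of \<open>x\<close>, since the other terms vanish and
  \<^const>\<open>sum\<close> over an infinite set is 0 by convention. The graph is meant to be locally finite.\<close>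

definition laplacian ::
  "'v set \<Rightarrow> ('v \<Rightarrow> 'v \<Rightarrow> 'k::linordered_field) \<Rightarrow> ('v \<Rightarrow> 'k) \<Rightarrow> ('v \<Rightarrow> 'k) \<Rightarrow> 'v \<Rightarrow> 'k" where
  "laplacian V b m f x = 1 / m x * (\<Sum>y | adj V b x y. (f x - f y) * b x y)"

definition superharmonic ::
  "'v set \<Rightarrow> ('v \<Rightarrow> 'v \<Rightarrow> 'k::linordered_field) \<Rightarrow> ('v \<Rightarrow> 'k) \<Rightarrow> ('v \<Rightarrow> 'k) \<Rightarrow> bool" where
  "superharmonic V b m u \<longleftrightarrow> (\<forall>x\<in>V. laplacian V b m u x \<ge> 0)"

section \<open>Capacity\<close>

text \<open>The solution \<open>v\<close> is required to vanish on the whole complement of \<open>K\<close>, that is, a function on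
  \<open>V\<close> is extended by 0 to the type; otherwise it would not be unique as a HOL function. Existence and
  uniqueness hold for finite connected \<open>K \<subseteq> V\<close> with \<open>a \<in> K\<close>.\<close>

definition is_equilibrium_potential ::
  "'v set \<Rightarrow> ('v \<Rightarrow> 'v \<Rightarrow> 'k::linordered_field) \<Rightarrow> ('v \<Rightarrow> 'k) \<Rightarrow> 'v set \<Rightarrow> 'v \<Rightarrow> ('v \<Rightarrow> 'k) \<Rightarrow> bool"
where
  "is_equilibrium_potential V b m K a v \<longleftrightarrow>
     (\<forall>x \<in> K - {a}. laplacian V b m v x = 0) \<and> v a = 1 \<and> (\<forall>x. x \<notin> K \<longrightarrow> v x = 0)"

definition equilibrium_potential ::
  "'v set \<Rightarrow> ('v \<Rightarrow> 'v \<Rightarrow> 'k::linordered_field) \<Rightarrow> ('v \<Rightarrow> 'k) \<Rightarrow> 'v set \<Rightarrow> 'v \<Rightarrow> 'v \<Rightarrow> 'k" where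
  "equilibrium_potential V b m K a = (THE v. is_equilibrium_potential V b m K a v)"

definition cap_on ::
  "'v set \<Rightarrow> ('v \<Rightarrow> 'v \<Rightarrow> 'k::linordered_field) \<Rightarrow> ('v \<Rightarrow> 'k) \<Rightarrow> 'v set \<Rightarrow> 'v \<Rightarrow> 'k" where
  "cap_on V b m K a = laplacian V b m (equilibrium_potential V b m K a) a * m a"

text \<open>Only \<open>n \<ge> 1\<close> is meaningful, as the ball of radius 0 is empty.\<close>

definition cap_ball ::
  "'v set \<Rightarrow> ('v \<Rightarrow> 'v \<Rightarrow> 'k::linordered_field) \<Rightarrow> ('v \<Rightarrow> 'k) \<Rightarrow> 'v \<Rightarrow> nat \<Rightarrow> 'k" where
  "cap_ball V b m a n = cap_on V b m (graph_ball V b a n) a"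

definition positive_capacity ::
  "'v set \<Rightarrow> ('v \<Rightarrow> 'v \<Rightarrow> 'k::linordered_field) \<Rightarrow> ('v \<Rightarrow> 'k) \<Rightarrow> bool" where
  "positive_capacity V b m \<longleftrightarrow> (\<exists>a\<in>V. \<exists>c. c \<noteq> 0 \<and> converges_to (cap_ball V b m a) c)"

end

theory Submission
  imports Defs
begin

text \<open>The equilibrium potentials \<open>v\<^sub>n\<close> of the balls around \<open>a\<close> increase with \<open>n\<close> by the minimum
  principle. Since \<open>v\<^sub>n\<close> is harmonic near any given \<open>x \<noteq> a\<close> once \<open>n\<close> is large, and since its
  Laplacian at \<open>a\<close> is the convergent capacity up to the factor \<open>m a\<close>, convergence of \<open>v\<^sub>n x\<close> gives
  convergence of the weighted sum of the values of \<open>v\<^sub>n\<close> over the neighbours of \<open>x\<close>. By monotonicity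
  the single terms of that sum are then Cauchy. Starting from \<open>v\<^sub>n a = 1\<close>, connectedness yields a
  pointwise limit. It is harmonic off \<open>a\<close> and has positive Laplacian at \<open>a\<close>, so it is superharmonic
  and not constant, and as it is nonnegative and not identically zero it vanishes nowhere.\<close>

section \<open>Convergence in ordered fields\<close>

lemma converges_to_const: "converges_to (\<lambda>n. c) c"
  by (simp add: converges_to_def)

lemma converges_to_add:
  assumes "converges_to s k" and "converges_to t l"
  shows "converges_to (\<lambda>n. s n + t n) (k + l)"
  unfolding converges_to_def
proof (intro allI impI)
  fix c :: 'a assume "c > 0"
  then have c: "c / 2 > 0" by simp
  obtain N where N: "\<forall>n\<ge>N. \<bar>s n - k\<bar> \<le> c / 2"
    using assms(1) c unfolding converges_to_def by blast
  obtain M where M: "\<forall>n\<ge>M. \<bar>t n - l\<bar> \<le> c / 2"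
    using assms(2) c unfolding converges_to_def by blast
  have "\<bar>s n + t n - (k + l)\<bar> \<le> c" if "n \<ge> max N M" for n
  proof -
    have "\<bar>s n + t n - (k + l)\<bar> \<le> \<bar>s n - k\<bar> + \<bar>t n - l\<bar>"
      using abs_triangle_ineq[of "s n - k" "t n - l"] by (simp add: algebra_simps)
    also have "\<dots> \<le> c / 2 + c / 2" using N M that by (intro add_mono) auto
    finally show ?thesis by simp
  qed
  then show "\<exists>N. \<forall>n\<ge>N. \<bar>s n + t n - (k + l)\<bar> \<le> c" by blast
qed

lemma converges_to_cmult:
  assumes "converges_to s l"
  shows "converges_to (\<lambda>n. d * s n) (d * l)"
proof (cases "d = 0")
  case True
  then show ?thesis by (simp add: converges_to_const)
next
  case False
  show ?thesis unfolding converges_to_def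
  proof (intro allI impI)
    fix c :: 'a assume "c > 0"
    then have "c / \<bar>d\<bar> > 0" using False by simp
    then obtain N where "\<forall>n\<ge>N. \<bar>s n - l\<bar> \<le> c / \<bar>d\<bar>"
      using assms unfolding converges_to_def by blast
    then have "\<forall>n\<ge>N. \<bar>d * s n - d * l\<bar> \<le> c"
      using False by (simp add: pos_le_divide_eq abs_mult mult.commute flip: right_diff_distrib)
    then show "\<exists>N. \<forall>n\<ge>N. \<bar>d * s n - d * l\<bar> \<le> c" by blast
  qed
qed

lemma converges_to_diff:
  assumes "converges_to s k" and "converges_to t l"
  shows "converges_to (\<lambda>n. s n - t n) (k - l)"
  using converges_to_add[OF assms(1) converges_to_cmult[OF assms(2), of "-1"]] by simp

lemma converges_to_sum:
  assumes "finite A" and "\<And>x. x \<in> A \<Longrightarrow> converges_to (s x) (l x)"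
  shows "converges_to (\<lambda>n. \<Sum>x\<in>A. s x n) (\<Sum>x\<in>A. l x)"
  using assms
  by (induction A rule: finite_induct) (auto intro!: converges_to_const converges_to_add)

lemma converges_to_nonneg:
  assumes "converges_to s l" and "\<And>n. s n \<ge> 0"
  shows "l \<ge> 0"
proof (rule ccontr)
  assume "\<not> l \<ge> 0"
  \<comment> \<open>This tolerance is below \<open>- l\<close>, while nonnegative terms stay at
    distance at least \<open>- l\<close> from a negative \<open>l\<close>.\<close>
  then have l: "- l / 2 > 0" by simp
  then obtain N where "\<bar>s N - l\<bar> \<le> - l / 2"
    using assms(1) unfolding converges_to_def by blast
  then have "- l \<le> - l / 2" using assms(2)[of N] by (simp add: abs_le_iff)
  then show False using l by simp
qed

text \<open>The differences of \<open>s\<close> with itself are zero, so nonnegativity of limits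
  applies to both \<open>k - l\<close> and \<open>l - k\<close>.\<close>

lemma converges_to_unique:
  assumes "converges_to s k" and "converges_to s l"
  shows "k = l"
  using converges_to_nonneg[OF converges_to_diff[OF assms]]
    converges_to_nonneg[OF converges_to_diff[OF assms(2,1)]] by simp

lemma converges_to_cong_eventually:
  assumes "converges_to s l" and "\<And>n. n \<ge> N \<Longrightarrow> t n = s n"
  shows "converges_to t l"
  unfolding converges_to_def
proof (intro allI impI)
  fix c :: 'a assume "c > 0"
  then obtain M where "\<forall>n\<ge>M. \<bar>s n - l\<bar> \<le> c"
    using assms(1) unfolding converges_to_def by blast
  then have "\<forall>n\<ge>max N M. \<bar>t n - l\<bar> \<le> c" using assms(2) by simp
  then show "\<exists>N. \<forall>n\<ge>N. \<bar>t n - l\<bar> \<le> c" by blast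
qed

lemma converges_to_Suc:
  assumes "converges_to s l"
  shows "converges_to (\<lambda>n. s (Suc n)) l"
  using assms unfolding converges_to_def by (meson le_SucI)

text \<open>In an ordered field a bounded monotone sequence need not be Cauchy. A convergent
  \<open>t\<close> with larger increments makes up for this: once \<open>t\<close> stays within
  \<open>c / 2\<close> of its limit, the increments of \<open>s\<close> are at most
  \<open>c\<close>.\<close>

lemma cauchy_seq_increment_le:
  fixes s t :: "nat \<Rightarrow> 'a::linordered_field"
  assumes "converges_to t l" and "mono s" and "\<And>i j. i \<le> j \<Longrightarrow> s j - s i \<le> t j - t i"
  shows "cauchy_seq s"
  unfolding cauchy_seq_def
proof (intro allI impI)
  fix c :: 'a assume "c > 0"
  then have "c / 2 > 0" by simp
  then obtain N where N: "\<forall>n\<ge>N. \<bar>t n - l\<bar> \<le> c / 2"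
    using assms(1) unfolding converges_to_def by blast
  have le: "\<bar>s i - s j\<bar> \<le> c" if "j \<ge> N" "j \<le> i" for i j
  proof -
    have "\<bar>s i - s j\<bar> = s i - s j" using monoD[OF assms(2) that(2)] by simp
    also have "\<dots> \<le> t i - t j" using assms(3) that(2) .
    also have "\<dots> \<le> \<bar>t i - l\<bar> + \<bar>t j - l\<bar>"
      using abs_ge_self[of "t i - l"] abs_ge_minus_self[of "t j - l"]
      by (simp add: algebra_simps)
    also have "\<dots> \<le> c / 2 + c / 2" using N that by (intro add_mono) auto
    finally show ?thesis by simp
  qed
  have "\<bar>s i - s j\<bar> \<le> c" if "i \<ge> N" "j \<ge> N" for i j
    using le[of j i] le[of i j] that by (metis abs_minus_commute nat_le_linear)
  then show "\<exists>N. \<forall>i\<ge>N. \<forall>j\<ge>N. \<bar>s i - s j\<bar> \<le> c" by blast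
qed

section \<open>The Dirichlet problem\<close>

locale connected_weighted_graph = weighted_graph V b m
  for V :: "'v set"
    and b :: "'v \<Rightarrow> 'v \<Rightarrow> 'k::linordered_field"
    and m :: "'v \<Rightarrow> 'k" +
  assumes locally_finite: "graph_locally_finite V b"
    and connected: "graph_connected V b"
begin

lemma finite_neighbours: "finite {y. adj V b x y}"
  using locally_finite by (cases "x \<in> V") (auto simp: graph_locally_finite_def adj_def)

lemma adj_weight_pos: "adj V b x y \<Longrightarrow> b x y > 0"
  using b_nonneg[of x y] by (auto simp: adj_def)

text \<open>Connectedness as an induction rule: it carries a minimal value, a zero or convergence
  from one vertex to the others.\<close>

lemma adj_induct:
  assumes "x \<in> V" and "y \<in> V" and "P x" and "\<And>y z. adj V b y z \<Longrightarrow> P y \<Longrightarrow> P z"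
  shows "P y"
proof -
  have "(adj V b)\<^sup>*\<^sup>* x y" using connected assms(1,2) by (simp add: graph_connected_def)
  then show ?thesis by (induction rule: rtranclp_induct) (use assms(3,4) in auto)
qed

lemma laplacian_add_scaled:
  "laplacian V b m (\<lambda>x. f x + t * g x) x = laplacian V b m f x + t * laplacian V b m g x"
proof -
  have "(\<Sum>y | adj V b x y. (f x + t * g x - (f y + t * g y)) * b x y)
      = (\<Sum>y | adj V b x y. (f x - f y) * b x y) + t * (\<Sum>y | adj V b x y. (g x - g y) * b x y)"
    by (simp add: sum_distrib_left algebra_simps flip: sum.distrib)
  then show ?thesis by (simp add: laplacian_def algebra_simps add_divide_distrib)
qed

lemma laplacian_diff:
  "laplacian V b m (\<lambda>x. f x - g x) x = laplacian V b m f x - laplacian V b m g x"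
  using laplacian_add_scaled[of f "-1" g x] by simp

lemma laplacian_const: "laplacian V b m (\<lambda>x. c) x = 0"
  by (simp add: laplacian_def)

text \<open>Minimality makes every term \<open>(f x - f y) * b x y\<close> nonpositive while their
  sum is nonnegative, so each term vanishes, and weights of edges are positive.\<close>

lemma laplacian_nonneg_at_minimum:
  assumes "laplacian V b m f x \<ge> 0" and "\<And>y. y \<in> V \<Longrightarrow> f x \<le> f y" and "adj V b x y"
  shows "f y = f x"
proof -
  have "m x > 0" using assms(3) m_pos by (simp add: adj_def)
  then have "0 \<le> (\<Sum>y | adj V b x y. (f x - f y) * b x y)"
    using assms(1) by (simp add: laplacian_def zero_le_divide_iff)
  then have "(\<Sum>y | adj V b x y. (f y - f x) * b x y) \<le> 0"
    by (simp add: left_diff_distrib sum_subtractf)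
  moreover have nonneg: "\<forall>y\<in>{y. adj V b x y}. 0 \<le> (f y - f x) * b x y"
    using assms(2) b_nonneg by (auto simp: adj_def)
  ultimately have "(\<Sum>y | adj V b x y. (f y - f x) * b x y) = 0"
    by (meson antisym sum_nonneg)
  then have "(f y - f x) * b x y = 0"
    using sum_nonneg_eq_0_iff[of "{y. adj V b x y}" "\<lambda>y. (f y - f x) * b x y"]
      finite_neighbours nonneg assms(3) by simp
  then show ?thesis using adj_weight_pos[OF assms(3)] by simp
qed

text \<open>A negative minimum over \<open>F\<close> is a minimum over \<open>V\<close>, because the
  values off \<open>F\<close> are nonnegative. A vertex attaining it lies in \<open>F\<close>, where
  superharmonicity passes it on to all neighbours; connectedness then takes it to \<open>a\<close>,
  outside \<open>F\<close>.\<close>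

lemma minimum_principle:
  assumes "finite F" and "F \<subseteq> V" and "a \<in> V - F"
    and superharm: "\<And>x. x \<in> F \<Longrightarrow> laplacian V b m f x \<ge> 0"
    and boundary: "\<And>x. x \<in> V - F \<Longrightarrow> f x \<ge> 0"
    and "x \<in> V"
  shows "f x \<ge> 0"
proof (rule ccontr)
  assume neg: "\<not> f x \<ge> 0"
  then have "x \<in> F" using boundary assms(6) by blast
  define c where "c = Min (f ` F)"
  have le: "c \<le> f y" if "y \<in> F" for y using that assms(1) by (simp add: c_def)
  have c: "c < 0" using le[OF \<open>x \<in> F\<close>] neg by simp
  have min: "c \<le> f y" if "y \<in> V" for y
    using that le boundary c by (cases "y \<in> F") force+
  obtain z where z: "z \<in> F" "f z = c"
    using Min_in[of "f ` F"] assms(1) \<open>x \<in> F\<close> unfolding c_def by fastforce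
  have "f a = c"
  proof (rule adj_induct[of z a])
    fix y w assume "adj V b y w" "f y = c"
    moreover have "y \<in> F"
      using calculation boundary[of y] c by (auto simp: adj_def not_less[symmetric])
    ultimately show "f w = c"
      using laplacian_nonneg_at_minimum[of f y w] superharm min by simp
  qed (use z assms(2,3) in auto)
  then show False using boundary[of a] c assms(3) by simp
qed

text \<open>Both differences are harmonic on \<open>F\<close> and zero off it, so the minimum
  principle applies to each.\<close>

lemma harmonic_extension_unique:
  assumes "finite F" and "F \<subseteq> V" and "a \<in> V - F"
    and "\<And>x. x \<in> F \<Longrightarrow> laplacian V b m f x = 0" and "\<And>x. x \<in> F \<Longrightarrow> laplacian V b m g x = 0"
    and "\<And>x. x \<notin> F \<Longrightarrow> f x = g x"
  shows "f = g"
proof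
  fix x
  show "f x = g x"
  proof (cases "x \<in> F")
    case True
    have "f x - g x \<ge> 0"
      by (rule minimum_principle[OF assms(1-3), where f = "\<lambda>x. f x - g x"])
        (use assms True in \<open>auto simp: laplacian_diff\<close>)
    moreover have "g x - f x \<ge> 0"
      by (rule minimum_principle[OF assms(1-3), where f = "\<lambda>x. g x - f x"])
        (use assms True in \<open>auto simp: laplacian_diff\<close>)
    ultimately show ?thesis by simp
  qed (use assms(6) in auto)
qed

text \<open>Induction on \<open>F\<close>: a new vertex \<open>x\<close> is made harmonic by adding a multiple of the extension
  of the indicator of \<open>x\<close>, whose Laplacian at \<open>x\<close> is nonzero by uniqueness.\<close>

lemma harmonic_extension_exists:
  assumes "finite F" and "F \<subseteq> V" and "a \<in> V - F"
  shows "\<exists>f. (\<forall>x\<in>F. laplacian V b m f x = 0) \<and> (\<forall>x. x \<notin> F \<longrightarrow> f x = g x)"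
  using assms
proof (induction F arbitrary: g rule: finite_induct)
  case empty
  then show ?case by auto
next
  case (insert x F)
  have IH: "\<exists>f. (\<forall>y\<in>F. laplacian V b m f y = 0) \<and> (\<forall>y. y \<notin> F \<longrightarrow> f y = h y)" for h
    using insert.IH insert.prems by auto
  obtain f where f: "\<forall>y\<in>F. laplacian V b m f y = 0" "\<forall>y. y \<notin> F \<longrightarrow> f y = g y"
    using IH[of g] by auto
  obtain e where e: "\<forall>y\<in>F. laplacian V b m e y = 0"
      "\<forall>y. y \<notin> F \<longrightarrow> e y = (if y = x then 1 else 0)"
    using IH[of "\<lambda>y. if y = x then 1 else 0"] by auto
  have "laplacian V b m e x \<noteq> 0"
  proof
    assume "laplacian V b m e x = 0"
    then have "e = (\<lambda>_. 0)"
      using insert.hyps insert.prems e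
      by (intro harmonic_extension_unique[of "insert x F" a]) (auto simp: laplacian_const)
    then show False using e(2) insert.hyps(2) by (auto dest: spec[of _ x])
  qed
  then obtain t where t: "laplacian V b m f x + t * laplacian V b m e x = 0"
    by (metis add.right_inverse nonzero_eq_divide_eq)
  have "\<forall>y\<in>insert x F. laplacian V b m (\<lambda>y. f y + t * e y) y = 0"
    using f(1) e(1) t by (auto simp: laplacian_add_scaled)
  moreover have "\<forall>y. y \<notin> insert x F \<longrightarrow> f y + t * e y = g y"
    using f(2) e(2) by simp
  ultimately show ?case by blast
qed

text \<open>The vertex \<open>a\<close> is treated as boundary: harmonic extension into
  \<open>K - {a}\<close> of the indicator of \<open>a\<close> exists and is unique, as the definite
  description requires.\<close>

lemma is_equilibrium_potential:
  assumes "finite K" and "K \<subseteq> V" and "a \<in> K"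
  shows "is_equilibrium_potential V b m K a (equilibrium_potential V b m K a)"
  unfolding equilibrium_potential_def
proof (rule theI'[of "is_equilibrium_potential V b m K a"])
  have K: "finite (K - {a})" "K - {a} \<subseteq> V" "a \<in> V - (K - {a})" using assms by auto
  show "\<exists>!v. is_equilibrium_potential V b m K a v"
  proof (rule ex_ex1I)
    obtain f where f: "\<forall>x\<in>K - {a}. laplacian V b m f x = 0"
        "\<forall>x. x \<notin> K - {a} \<longrightarrow> f x = (if x = a then 1 else 0)"
      using harmonic_extension_exists[OF K, of "\<lambda>x. if x = a then 1 else 0"] by auto
    then have "is_equilibrium_potential V b m K a f"
      using assms by (auto simp: is_equilibrium_potential_def)
    then show "\<exists>v. is_equilibrium_potential V b m K a v" by blast
  next
    fix v w
    assume "is_equilibrium_potential V b m K a v" "is_equilibrium_potential V b m K a w"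
    then show "v = w"
      by (intro harmonic_extension_unique[OF K]) (auto simp: is_equilibrium_potential_def)
  qed
qed

section \<open>Exhaustion by balls\<close>

lemma finite_relpow_adj: "finite {y. (adj V b ^^ n) x y}"
proof (induction n)
  case (Suc n)
  have "{y. (adj V b ^^ Suc n) x y} = (\<Union>z\<in>{z. (adj V b ^^ n) x z}. {y. adj V b z y})"
    by auto
  then show ?case using Suc finite_neighbours by simp
qed simp

lemma relpow_graph_dist:
  assumes "x \<in> V" and "y \<in> V"
  shows "(adj V b ^^ graph_dist V b x y) x y"
proof -
  have "\<exists>n. (adj V b ^^ n) x y"
    using connected assms by (simp add: graph_connected_def rtranclp_power)
  then show ?thesis unfolding graph_dist_def by (rule LeastI_ex)
qed

lemma finite_graph_ball:
  assumes "a \<in> V"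
  shows "finite (graph_ball V b a n)"
proof (rule finite_subset)
  \<comment> \<open>The distance is the length of an actual walk, and local finiteness leaves
    finitely many endpoints for each length.\<close>
  show "graph_ball V b a n \<subseteq> (\<Union>i<n. {y. (adj V b ^^ i) a y})"
    using relpow_graph_dist[OF assms] by (auto simp: graph_ball_def)
qed (simp add: finite_relpow_adj)

lemma center_in_graph_ball: "a \<in> V \<Longrightarrow> a \<in> graph_ball V b a (Suc n)"
  using Least_le[of "\<lambda>n. (adj V b ^^ n) a a" 0]
  by (simp add: graph_ball_def graph_dist_def)

text \<open>A zero of a nonnegative function is a global minimum, so it spreads to the neighbours
  and reaches \<open>a\<close>, against \<open>u a \<noteq> 0\<close>.\<close>

lemma superharmonic_pos:
  assumes "superharmonic V b m u" and "\<And>x. x \<in> V \<Longrightarrow> u x \<ge> 0" and "a \<in> V" and "u a \<noteq> 0"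
    and "x \<in> V"
  shows "u x > 0"
proof (rule ccontr)
  assume "\<not> u x > 0"
  then have "u x = 0" using assms(2,5) by (auto simp: less_le)
  have "u a = 0"
  proof (rule adj_induct[of x a])
    fix y z assume "adj V b y z" "u y = 0"
    then show "u z = 0"
      using laplacian_nonneg_at_minimum[of u y z] assms(1,2)
      by (simp add: superharmonic_def adj_def)
  qed (use assms(3,5) \<open>u x = 0\<close> in auto)
  then show False using assms(4) by simp
qed

lemma exists_superharmonic_of_capacity:
  assumes complete: "cauchy_complete TYPE('k)"
    and a: "a \<in> V" and "c \<noteq> 0" and cap: "converges_to (cap_ball V b m a) c"
  shows "\<exists>u. (\<forall>x\<in>V. u x > 0) \<and> superharmonic V b m u \<and> (\<exists>x\<in>V. \<exists>y\<in>V. u x \<noteq> u y)"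
proof -

  \<comment> \<open>Equilibrium potentials of the balls: bounds and monotonicity\<close>
  define B where "B n = graph_ball V b a (Suc n)" for n
  define v where "v n = equilibrium_potential V b m (B n) a" for n
  \<comment> \<open>Radius \<open>Suc n\<close> instead of \<open>n\<close> keeps \<open>a\<close>
    in every \<open>B n\<close>; the ball of radius 0 would be empty.\<close>
  have B: "finite (B n)" "B n \<subseteq> V" "a \<in> B n" for n
    unfolding B_def using finite_graph_ball center_in_graph_ball a
    by (auto simp: graph_ball_def)
  then have F: "finite (B n - {a})" "B n - {a} \<subseteq> V" "a \<in> V - (B n - {a})" for n
    using a by auto
  have "is_equilibrium_potential V b m (B n) a (v n)" for n
    unfolding v_def using is_equilibrium_potential[OF B] .
  then have harm: "x \<in> B n - {a} \<Longrightarrow> laplacian V b m (v n) x = 0"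
    and v_a: "v n a = 1"
    and v_out: "x \<notin> B n \<Longrightarrow> v n x = 0" for n x
    by (auto simp: is_equilibrium_potential_def)
  \<comment> \<open>The boundary consists of \<open>a\<close>, with value 1, and the vertices
    outside \<open>B n\<close>, with value 0.\<close>
  have v_nonneg: "v n x \<ge> 0" if "x \<in> V" for n x
  proof (rule minimum_principle[OF F])
    fix y assume "y \<in> V - (B n - {a})"
    then show "0 \<le> v n y" using v_a v_out by (cases "y = a") auto
  qed (use that harm in auto)
  have v_le_1: "v n x \<le> 1" if "x \<in> V" for n x
  proof -
    have "0 \<le> 1 - v n x"
    proof (rule minimum_principle[OF F, where f = "\<lambda>x. 1 - v n x"])
      fix y assume "y \<in> V - (B n - {a})"
      then show "0 \<le> 1 - v n y" using v_a v_out by (cases "y = a") auto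
    qed (use that harm in \<open>auto simp: laplacian_diff laplacian_const\<close>)
    then show ?thesis by simp
  qed
  have v_mono: "mono (\<lambda>n. v n x)" if "x \<in> V" for x
  proof (rule mono_iff_le_Suc[THEN iffD2], rule allI)
    fix n
    \<comment> \<open>As \<open>B n\<close> lies in \<open>B (Suc n)\<close>, the difference is
      harmonic on \<open>B n - {a}\<close>. On the boundary, both potentials are 1 at
      \<open>a\<close>, and \<open>v n\<close> is 0 elsewhere.\<close>
    have "0 \<le> v (Suc n) x - v n x"
    proof (rule minimum_principle[OF F, where f = "\<lambda>x. v (Suc n) x - v n x"])
      fix y assume y: "y \<in> B n - {a}"
      then have "y \<in> B (Suc n) - {a}" by (auto simp: B_def graph_ball_def)
      with y harm show "0 \<le> laplacian V b m (\<lambda>x. v (Suc n) x - v n x) y"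
        by (simp add: laplacian_diff)
    next
      fix y assume "y \<in> V - (B n - {a})"
      then show "0 \<le> v (Suc n) y - v n y"
        using v_a v_out v_nonneg by (cases "y = a") auto
    qed (rule that)
    then show "v n x \<le> v (Suc n) x" by simp
  qed

  \<comment> \<open>Limits of the Laplacians\<close>
  have m_a: "m a > 0" using m_pos a .
  have cap_v: "laplacian V b m (v n) a = 1 / m a * cap_ball V b m a (Suc n)" for n
    using m_a by (simp add: cap_ball_def cap_on_def v_def B_def)
  have lap_a: "converges_to (\<lambda>n. laplacian V b m (v n) a) (1 / m a * c)"
    unfolding cap_v by (rule converges_to_cmult[OF converges_to_Suc[OF cap]])
  have lap_off: "converges_to (\<lambda>n. laplacian V b m (v n) x) 0" if "x \<in> V" "x \<noteq> a" for x
  proof (rule converges_to_cong_eventually[OF converges_to_const])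
    \<comment> \<open>Having radius \<open>Suc n\<close>, \<open>B n\<close> contains
      \<open>x\<close> from \<open>n = graph_dist V b a x\<close> on, and then \<open>v n\<close> is
      harmonic at \<open>x\<close>.\<close>
    fix n assume "n \<ge> graph_dist V b a x"
    then show "laplacian V b m (v n) x = 0"
      using that by (intro harm) (auto simp: B_def graph_ball_def)
  qed
  \<comment> \<open>\<open>v n\<close> has its maximum 1 at \<open>a\<close>, so its Laplacian there
    is nonnegative; a nonzero capacity is therefore positive.\<close>
  have "0 \<le> laplacian V b m (v n) a" for n
    using m_a v_le_1 v_a
    by (auto simp: laplacian_def adj_def intro!: divide_nonneg_pos sum_nonneg mult_nonneg_nonneg b_nonneg)
  then have lap_a_pos: "1 / m a * c > 0"
    using converges_to_nonneg[OF lap_a] \<open>c \<noteq> 0\<close> m_a by (simp add: less_le)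

  \<comment> \<open>Pointwise convergence of the potentials\<close>
  have conv: "\<exists>l. converges_to (\<lambda>n. v n x) l" if "x \<in> V" for x
  proof (rule adj_induct[OF a that])
    show "\<exists>l. converges_to (\<lambda>n. v n a) l"
      using converges_to_const by (auto simp: v_a)
  next
    fix x y assume xy: "adj V b x y" and "\<exists>l. converges_to (\<lambda>n. v n x) l"
    then obtain l where l: "converges_to (\<lambda>n. v n x) l" by blast
    have V: "x \<in> V" "y \<in> V" using xy by (auto simp: adj_def)
    obtain L where L: "converges_to (\<lambda>n. laplacian V b m (v n) x) L"
      using lap_a lap_off V by (cases "x = a") auto
    \<comment> \<open>The neighbour sum isolated from the Laplacian at \<open>x\<close>: it is a
      combination of \<open>v n x\<close> and that Laplacian, and both converge.\<close>
    define t where "t n = (\<Sum>z | adj V b x z. b x z * v n z)" for n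
    have "t n = (\<Sum>z | adj V b x z. b x z) * v n x - m x * laplacian V b m (v n) x" for n
      using m_pos[OF V(1)]
      by (simp add: t_def laplacian_def sum_distrib_left sum_distrib_right algebra_simps
          flip: sum_subtractf)
    then have t: "converges_to t ((\<Sum>z | adj V b x z. b x z) * l - m x * L)"
      using converges_to_diff[OF converges_to_cmult[OF l] converges_to_cmult[OF L]] by presburger
    have "cauchy_seq (\<lambda>n. b x y * v n y)"
    proof (rule cauchy_seq_increment_le[OF t])
      show "mono (\<lambda>n. b x y * v n y)"
        using v_mono V b_nonneg by (auto simp: mono_def intro!: mult_left_mono)
      fix i j :: nat assume ij: "i \<le> j"
      \<comment> \<open>Monotonicity in \<open>n\<close> makes all summands nonnegative, so a single
        one is at most their sum.\<close>
      have "b x y * v j y - b x y * v i y \<le> (\<Sum>z | adj V b x z. b x z * v j z - b x z * v i z)"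
        using xy v_mono ij finite_neighbours[of x]
        by (intro member_le_sum[where f = "\<lambda>z. b x z * v j z - b x z * v i z"])
          (auto simp: adj_def mono_def intro!: mult_left_mono b_nonneg)
      then show "b x y * v j y - b x y * v i y \<le> t j - t i"
        by (simp add: t_def sum_subtractf)
    qed
    then obtain k where "converges_to (\<lambda>n. b x y * v n y) k"
      using complete unfolding cauchy_complete_def by blast
    then have "converges_to (\<lambda>n. 1 / b x y * (b x y * v n y)) (1 / b x y * k)"
      by (rule converges_to_cmult)
    then show "\<exists>l. converges_to (\<lambda>n. v n y) l" using adj_weight_pos[OF xy] by auto
  qed

  \<comment> \<open>The limit function\<close>
  then obtain u where u: "converges_to (\<lambda>n. v n x) (u x)" if "x \<in> V" for x
    by metis
  have u_nonneg: "u x \<ge> 0" if "x \<in> V" for x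
    using converges_to_nonneg[OF u[OF that]] v_nonneg that by blast
  have u_a: "u a = 1"
    using converges_to_unique[OF u[OF a]] by (simp add: v_a converges_to_const)
  \<comment> \<open>The neighbour sum is finite, so the Laplacian commutes with the pointwise
    limit.\<close>
  have lap_u: "converges_to (\<lambda>n. laplacian V b m (v n) x) (laplacian V b m u x)" if "x \<in> V" for x
  proof -
    have "converges_to (\<lambda>n. \<Sum>y | adj V b x y. b x y * (v n x - v n y))
        (\<Sum>y | adj V b x y. b x y * (u x - u y))"
      using finite_neighbours[of x] u that
      by (intro converges_to_sum converges_to_cmult converges_to_diff) (auto simp: adj_def)
    from converges_to_cmult[OF this, of "1 / m x"] show ?thesis
      by (simp only: laplacian_def mult.commute[of "b x _"])
  qed
  \<comment> \<open>Two limits of one sequence agree: the Laplacian of \<open>u\<close> at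
    \<open>a\<close> is \<open>1 / m a * c\<close>.\<close>
  have lap_u_a: "laplacian V b m u a > 0"
    using converges_to_unique[OF lap_u[OF a] lap_a] lap_a_pos by simp
  \<comment> \<open>Off \<open>a\<close> the Laplacian of \<open>u\<close> is the limit of an
    eventually vanishing sequence.\<close>
  have super: "superharmonic V b m u"
    unfolding superharmonic_def
  proof
    fix x assume "x \<in> V"
    then show "laplacian V b m u x \<ge> 0"
      using lap_u_a converges_to_unique[OF lap_u lap_off, of x] by (cases "x = a") auto
  qed
  have "\<exists>y\<in>V. u a \<noteq> u y"
  proof (rule ccontr)
    assume "\<not> (\<exists>y\<in>V. u a \<noteq> u y)"
    then have "laplacian V b m u a = 0"
      by (auto simp: laplacian_def adj_def intro!: sum.neutral)
    then show False using lap_u_a by simp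
  qed
  moreover have "\<forall>x\<in>V. u x > 0"
    using superharmonic_pos[OF super u_nonneg a] u_a by simp
  ultimately show ?thesis using super a by blast
qed

end

theorem theorem7p5:
  fixes V :: "'v set"
    and b :: "'v \<Rightarrow> 'v \<Rightarrow> 'k::linordered_field"
    and m :: "'v \<Rightarrow> 'k"
  assumes "non_archimedean TYPE('k)"
    and "cauchy_complete TYPE('k)"
    and "countable_cofinality TYPE('k)"
    and "weighted_graph V b m"
    and "infinite V"
    and "graph_locally_finite V b"
    and "graph_connected V b"
    and "positive_capacity V b m"
  shows "\<exists>u :: 'v \<Rightarrow> 'k. (\<forall>x\<in>V. u x > 0) \<and> superharmonic V b m u \<and>
           (\<exists>x\<in>V. \<exists>y\<in>V. u x \<noteq> u y)"
proof -
  interpret connected_weighted_graph V b m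
    using assms(4,6,7)
    by (simp add: connected_weighted_graph_def connected_weighted_graph_axioms_def)
  show ?thesis
    using exists_superharmonic_of_capacity[OF assms(2)] assms(8)
    unfolding positive_capacity_def by blast
qed

end
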